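(* Let $X$ be a topological space and $x_0\in X$. Then $X$ is an SLTL space at $x_0$ if and only if $(p^{-1}(x_0))^{wh}$ is a topological group.
   Context: Let $I=[0,1]$; $P(X,x_0)$ denotes the set of paths $\alpha:I\to X$ with $\alpha(0)=x_0$; $\ast$ denotes concatenation and $\alpha^{-1}$ the reversed path. A path $\alpha:I\to X$ is an SLT (small loop transfer) path if for every open neighborhood $U$ of $\alpha(0)$ in $X$ there is an open neighborhood $V$ of $\alpha(1)$ in $X$ such that for every loop $\gamma$ in $V$ based at $\alpha(1)$ there is a loop $\gamma'$ in $U$ based at $\alpha(0)$ which is homotopic in $X$, relative to $\{0,1\}$, to $\alpha\ast\gamma\ast\alpha^{-1}$. An SLT loop is a loop that is an SLT path. The space $X$ is SLTL at $x_0$ if every loop in $X$ based at $x_0$ is an SLT loop. $\widetilde{X}$ is the set of equivalence classes $\langle\alpha\rangle$ of $\alpha\in P(X,x_0)$ under: $\alpha_1\sim\alpha_2$ iff $\alpha_1(1)=\alpha_2(1)$ and $\alpha_1\ast\alpha_2^{-1}$ is nullhomotopic (rel endpoints). The whisker topology on $\widetilde{X}$ has as a basis the sets $(U,\langle\alpha\rangle)=\{\langle\beta\rangle\in\widetilde{X}\mid \beta\simeq\alpha\ast\varepsilon \text{ rel endpoints for some path } \varepsilon:(I,0)\to(U,\alpha(1))\}$, where $U$ is an open neighborhood of $\alpha(1)$; the resulting space is $\widetilde{X}^{wh}$. The map $p:\widetilde{X}^{wh}\to X$ is $p(\langle\alpha\rangle)=\alpha(1)$, and $(p^{-1}(x_0))^{wh}$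 is the fiber $p^{-1}(x_0)$ with the subspace topology. The fiber carries the group structure transported along the bijection $\pi_1(X,x_0)\to p^{-1}(x_0)$, $[\alpha]\mapsto\langle\alpha\rangle$; the topology induced on $\pi_1(X,x_0)$ by this bijection defines $\pi_1^{wh}(X,x_0)$, so that $(p^{-1}(x_0))^{wh}$ and $\pi_1^{wh}(X,x_0)$ are identified. *)

theory Defs
  imports "HOL-Analysis.Analysis" "HOL-Algebra.Group"
begin

text \<open>The space \<open>X\<close> is the carrier \<open>UNIV\<close> of a type of class \<open>topological_space\<close>.
  Paths are total functions on the reals of which only the values on the unit interval matter;
  two paths agreeing there are homotopic, so path classes are not affected.
  The constant path at \<open>x\<close> is written \<open>\<lambda>_. x\<close> because \<^const>\<open>linepath\<close> needs a vector space.\<close>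

subsection \<open>Small loop transfer\<close>

definition loops_in :: "'a::topological_space set \<Rightarrow> 'a \<Rightarrow> (real \<Rightarrow> 'a) set" where
  "loops_in U x = {\<gamma>. path \<gamma> \<and> path_image \<gamma> \<subseteq> U \<and> pathstart \<gamma> = x \<and> pathfinish \<gamma> = x}"

definition SLT_path :: "(real \<Rightarrow> 'a::topological_space) \<Rightarrow> bool" where
  "SLT_path \<alpha> \<longleftrightarrow> path \<alpha> \<and>
     (\<forall>U. open U \<and> pathstart \<alpha> \<in> U \<longrightarrow>
       (\<exists>V. open V \<and> pathfinish \<alpha> \<in> V \<and>
         (\<forall>\<gamma>\<in>loops_in V (pathfinish \<alpha>). \<exists>\<gamma>'\<in>loops_in U (pathstart \<alpha>).
            homotopic_paths UNIV \<gamma>' (\<alpha> +++ \<gamma> +++ reversepath \<alpha>))))"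

definition SLTL_at :: "'a::topological_space \<Rightarrow> bool" where
  "SLTL_at x0 \<longleftrightarrow> (\<forall>\<alpha>\<in>loops_in UNIV x0. SLT_path \<alpha>)"

subsection \<open>Path classes and the whisker topology\<close>

definition paths_from :: "'a::topological_space \<Rightarrow> (real \<Rightarrow> 'a) set" where
  "paths_from x0 = {\<alpha>. path \<alpha> \<and> pathstart \<alpha> = x0}"

definition path_rel :: "'a::topological_space \<Rightarrow> ((real \<Rightarrow> 'a) \<times> (real \<Rightarrow> 'a)) set" where
  "path_rel x0 = {(\<alpha>1, \<alpha>2). \<alpha>1 \<in> paths_from x0 \<and> \<alpha>2 \<in> paths_from x0 \<and>
     pathfinish \<alpha>1 = pathfinish \<alpha>2 \<and>
     homotopic_paths UNIV (\<alpha>1 +++ reversepath \<alpha>2) (\<lambda>_. x0)}"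

definition path_class :: "'a::topological_space \<Rightarrow> (real \<Rightarrow> 'a) \<Rightarrow> (real \<Rightarrow> 'a) set" where
  "path_class x0 \<alpha> = path_rel x0 `` {\<alpha>}"

definition path_classes :: "'a::topological_space \<Rightarrow> (real \<Rightarrow> 'a) set set" where
  "path_classes x0 = paths_from x0 // path_rel x0"

definition whisker_nbhd ::
  "'a::topological_space \<Rightarrow> 'a set \<Rightarrow> (real \<Rightarrow> 'a) \<Rightarrow> (real \<Rightarrow> 'a) set set" where
  "whisker_nbhd x0 U \<alpha> = {path_class x0 \<beta> | \<beta>. \<beta> \<in> paths_from x0 \<and>
     (\<exists>\<epsilon>. path \<epsilon> \<and> path_image \<epsilon> \<subseteq> U \<and> pathstart \<epsilon> = pathfinish \<alpha> \<and>
          homotopic_paths UNIV \<beta> (\<alpha> +++ \<epsilon>))}"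

definition whisker_basis :: "'a::topological_space \<Rightarrow> (real \<Rightarrow> 'a) set set set" where
  "whisker_basis x0 =
     {whisker_nbhd x0 U \<alpha> | U \<alpha>. \<alpha> \<in> paths_from x0 \<and> open U \<and> pathfinish \<alpha> \<in> U}"

text \<open>The generating family is a basis and not merely a subbasis; see
  \<open>openin_whisker_topology\<close> below.\<close>

definition whisker_topology :: "'a::topological_space \<Rightarrow> (real \<Rightarrow> 'a) set topology" where
  "whisker_topology x0 = topology_generated_by (whisker_basis x0)"

text \<open>The projection \<open>p\<close>; all representatives of a path class have the same endpoint.\<close>

definition endpoint :: "(real \<Rightarrow> 'a::topological_space) set \<Rightarrow> 'a" where
  "endpoint c = the_elem (pathfinish ` c)"

definition fiber :: "'a::topological_space \<Rightarrow> (real \<Rightarrow> 'a) set set" where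
  "fiber x0 = {c \<in> path_classes x0. endpoint c = x0}"

definition fiber_topology :: "'a::topological_space \<Rightarrow> (real \<Rightarrow> 'a) set topology" where
  "fiber_topology x0 = subtopology (whisker_topology x0) (fiber x0)"

subsection \<open>The fundamental group and the group structure on the fiber\<close>

definition loop_rel :: "'a::topological_space \<Rightarrow> ((real \<Rightarrow> 'a) \<times> (real \<Rightarrow> 'a)) set" where
  "loop_rel x0 = {(\<alpha>, \<beta>). \<alpha> \<in> loops_in UNIV x0 \<and> \<beta> \<in> loops_in UNIV x0 \<and>
     homotopic_paths UNIV \<alpha> \<beta>}"

definition fundamental_group :: "'a::topological_space \<Rightarrow> (real \<Rightarrow> 'a) set monoid" where
  "fundamental_group x0 =
     \<lparr>carrier = loops_in UNIV x0 // loop_rel x0,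
      monoid.mult = (\<lambda>A B. \<Union>\<alpha>\<in>A. \<Union>\<beta>\<in>B. loop_rel x0 `` {\<alpha> +++ \<beta>}),
      one = loop_rel x0 `` {\<lambda>_. x0}\<rparr>"

definition loop_class_to_fiber ::
  "'a::topological_space \<Rightarrow> (real \<Rightarrow> 'a) set \<Rightarrow> (real \<Rightarrow> 'a) set" where
  "loop_class_to_fiber x0 A = (\<Union>\<alpha>\<in>A. path_class x0 \<alpha>)"

definition fiber_group :: "'a::topological_space \<Rightarrow> (real \<Rightarrow> 'a) set monoid" where
  "fiber_group x0 =
     (let G = fundamental_group x0;
          \<phi> = loop_class_to_fiber x0;
          \<psi> = inv_into (carrier G) \<phi>
      in \<lparr>carrier = fiber x0,
          monoid.mult = (\<lambda>c d. \<phi> (\<psi> c \<otimes>\<^bsub>G\<^esub> \<psi> d)),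
          one = \<phi> \<one>\<^bsub>G\<^esub>\<rparr>)"

text \<open>No separation axiom is required.\<close>

definition topological_group :: "('g, 'm) monoid_scheme \<Rightarrow> 'g topology \<Rightarrow> bool" where
  "topological_group G T \<longleftrightarrow> group G \<and> topspace T = carrier G \<and>
     continuous_map (prod_topology T T) T (\<lambda>(x, y). x \<otimes>\<^bsub>G\<^esub> y) \<and>
     continuous_map T T (\<lambda>x. inv\<^bsub>G\<^esub> x)"

subsection \<open>Well-definedness\<close>

lemma homotopic_paths_const_right:
  fixes p :: "real \<Rightarrow> 'a::topological_space"
  assumes "path p"
  shows "homotopic_paths UNIV (p +++ (\<lambda>_. pathfinish p)) p"
proof -
  have c: "continuous_on {0..1} (\<lambda>t::real. min (2 * t) 1)"
    by (intro continuous_intros)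
  have "homotopic_paths UNIV p (p +++ (\<lambda>_. pathfinish p))"
    by (rule homotopic_paths_reparametrize[OF assms _ c])
       (auto simp: joinpaths_def pathfinish_def min_def)
  then show ?thesis by (rule homotopic_paths_sym)
qed

lemma homotopic_paths_const_left:
  fixes p :: "real \<Rightarrow> 'a::topological_space"
  assumes "path p"
  shows "homotopic_paths UNIV ((\<lambda>_. pathstart p) +++ p) p"
proof -
  have c: "continuous_on {0..1} (\<lambda>t::real. max (2 * t - 1) 0)"
    by (intro continuous_intros)
  have "homotopic_paths UNIV p ((\<lambda>_. pathstart p) +++ p)"
    by (rule homotopic_paths_reparametrize[OF assms _ c])
       (auto simp: joinpaths_def pathstart_def max_def)
  then show ?thesis by (rule homotopic_paths_sym)
qed

lemma homotopic_paths_reverse_right: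
  fixes p :: "real \<Rightarrow> 'a::topological_space"
  assumes "path p"
  shows "homotopic_paths UNIV (p +++ reversepath p) (\<lambda>_. pathstart p)"
proof -
  let ?f = "\<lambda>z::real\<times>real. (1 - fst z) * (1 - \<bar>2 * snd z - 1\<bar>)"
  have f01: "?f ` ({0..1} \<times> {0..1}) \<subseteq> {0..1}"
    by (auto intro!: mult_nonneg_nonneg mult_le_one)
  have "continuous_on ({0..1} \<times> {0..1}) (p \<circ> ?f)"
    by (rule continuous_on_compose)
       (auto intro!: continuous_intros continuous_on_subset[OF assms[unfolded path_def] f01])
  moreover have "(p \<circ> ?f) (0, x) = (p +++ reversepath p) x" for x
    by (auto simp: joinpaths_def reversepath_def abs_if algebra_simps)
  ultimately show ?thesis
    unfolding homotopic_paths
    by (intro exI[of _ "p \<circ> ?f"])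
       (auto simp: pathstart_def pathfinish_def joinpaths_def reversepath_def)
qed

lemma homotopic_paths_reverse_left:
  fixes p :: "real \<Rightarrow> 'a::topological_space"
  assumes "path p"
  shows "homotopic_paths UNIV (reversepath p +++ p) (\<lambda>_. pathfinish p)"
  using homotopic_paths_reverse_right[of "reversepath p"] assms by simp

lemma homotopic_paths_iff_null:
  fixes p q :: "real \<Rightarrow> 'a::topological_space"
  assumes "path p" "path q" "pathstart p = pathstart q" "pathfinish p = pathfinish q"
  shows "homotopic_paths UNIV (p +++ reversepath q) (\<lambda>_. pathstart p) \<longleftrightarrow> homotopic_paths UNIV p q"
proof
  assume h: "homotopic_paths UNIV (p +++ reversepath q) (\<lambda>_. pathstart p)"
  have "homotopic_paths UNIV p (p +++ (\<lambda>_. pathfinish p))"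
    using homotopic_paths_const_right assms(1) homotopic_paths_sym by blast
  also have "homotopic_paths UNIV \<dots> (p +++ (reversepath q +++ q))"
    using homotopic_paths_reverse_left[OF assms(2)] assms
    by (intro homotopic_paths_join) (auto simp: homotopic_paths_sym pathstart_def)
  also have "homotopic_paths UNIV \<dots> ((p +++ reversepath q) +++ q)"
    using assms by (intro homotopic_paths_assoc) auto
  also have "homotopic_paths UNIV \<dots> ((\<lambda>_. pathstart q) +++ q)"
    using h assms by (intro homotopic_paths_join) auto
  also have "homotopic_paths UNIV \<dots> q"
    using homotopic_paths_const_left assms(2) by blast
  finally show "homotopic_paths UNIV p q" .
next
  assume h: "homotopic_paths UNIV p q"
  have "homotopic_paths UNIV (p +++ reversepath q) (q +++ reversepath q)"
    using h assms by (intro homotopic_paths_join) auto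
  also have "homotopic_paths UNIV \<dots> (\<lambda>_. pathstart q)"
    using homotopic_paths_reverse_right assms(2) by blast
  finally show "homotopic_paths UNIV (p +++ reversepath q) (\<lambda>_. pathstart p)"
    using assms by simp
qed

lemma path_rel_iff:
  "(\<alpha>, \<beta>) \<in> path_rel x0 \<longleftrightarrow> \<alpha> \<in> paths_from x0 \<and> homotopic_paths UNIV \<alpha> \<beta>"
proof -
  have "\<beta> \<in> paths_from x0 \<and> pathfinish \<alpha> = pathfinish \<beta>"
    if "\<alpha> \<in> paths_from x0" "homotopic_paths UNIV \<alpha> \<beta>"
    using that homotopic_paths_imp_path[of UNIV \<alpha> \<beta>]
      homotopic_paths_imp_pathstart[of UNIV \<alpha> \<beta>]
      homotopic_paths_imp_pathfinish[of UNIV \<alpha> \<beta>] by (auto simp: paths_from_def)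
  then show ?thesis
    using homotopic_paths_iff_null[of \<alpha> \<beta>] by (auto simp: path_rel_def paths_from_def)
qed

lemma equiv_path_rel: "equiv (paths_from x0) (path_rel x0)"
proof (rule equivI)
  show "path_rel x0 \<subseteq> paths_from x0 \<times> paths_from x0" by (auto simp: path_rel_def)
  show "refl_on (paths_from x0) (path_rel x0)"
    by (auto simp: refl_on_def path_rel_iff) (auto simp: paths_from_def)
  show "sym (path_rel x0)"
  proof (rule symI)
    fix a b assume "(a, b) \<in> path_rel x0"
    moreover from this have "b \<in> paths_from x0" by (auto simp: path_rel_def)
    ultimately show "(b, a) \<in> path_rel x0" by (auto simp: path_rel_iff homotopic_paths_sym)
  qed
  show "trans (path_rel x0)"
    by (rule transI) (auto simp: path_rel_iff intro: homotopic_paths_trans)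
qed

lemma path_class_eq_iff:
  assumes "\<alpha> \<in> paths_from x0" "\<beta> \<in> paths_from x0"
  shows "path_class x0 \<alpha> = path_class x0 \<beta> \<longleftrightarrow> homotopic_paths UNIV \<alpha> \<beta>"
  using eq_equiv_class_iff[OF equiv_path_rel assms] assms
  by (simp add: path_class_def path_rel_iff)

lemma endpoint_path_class:
  assumes "\<alpha> \<in> paths_from x0"
  shows "endpoint (path_class x0 \<alpha>) = pathfinish \<alpha>"
proof -
  have "pathfinish ` path_class x0 \<alpha> = {pathfinish \<alpha>}"
    using assms equiv_class_self[OF equiv_path_rel assms]
    by (auto simp: path_class_def path_rel_def)
  then show ?thesis by (simp add: endpoint_def)
qed

lemma path_class_in_whisker_nbhd:
  assumes "\<alpha> \<in> paths_from x0" "\<beta> \<in> paths_from x0"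
  shows "path_class x0 \<beta> \<in> whisker_nbhd x0 U \<alpha> \<longleftrightarrow>
    (\<exists>\<epsilon>. path \<epsilon> \<and> path_image \<epsilon> \<subseteq> U \<and> pathstart \<epsilon> = pathfinish \<alpha> \<and>
         homotopic_paths UNIV \<beta> (\<alpha> +++ \<epsilon>))" (is "_ \<longleftrightarrow> ?R")
proof
  assume "path_class x0 \<beta> \<in> whisker_nbhd x0 U \<alpha>"
  then obtain \<beta>' \<epsilon> where *: "\<beta>' \<in> paths_from x0" "path_class x0 \<beta> = path_class x0 \<beta>'"
    "path \<epsilon>" "path_image \<epsilon> \<subseteq> U" "pathstart \<epsilon> = pathfinish \<alpha>"
    "homotopic_paths UNIV \<beta>' (\<alpha> +++ \<epsilon>)"
    unfolding whisker_nbhd_def by blast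
  then have "homotopic_paths UNIV \<beta> \<beta>'" using path_class_eq_iff assms(2) by blast
  then show ?R using * homotopic_paths_trans by blast
next
  assume ?R
  then show "path_class x0 \<beta> \<in> whisker_nbhd x0 U \<alpha>"
    using assms(2) unfolding whisker_nbhd_def by blast
qed

lemma whisker_nbhd_subset:
  assumes "\<alpha> \<in> paths_from x0" "\<gamma> \<in> paths_from x0" "path_class x0 \<gamma> \<in> whisker_nbhd x0 U \<alpha>"
    "V \<subseteq> U"
  shows "whisker_nbhd x0 V \<gamma> \<subseteq> whisker_nbhd x0 U \<alpha>"
proof
  fix c assume "c \<in> whisker_nbhd x0 V \<gamma>"
  then obtain \<delta> \<eta> where d: "c = path_class x0 \<delta>" "\<delta> \<in> paths_from x0"
    "path \<eta>" "path_image \<eta> \<subseteq> V" "pathstart \<eta> = pathfinish \<gamma>"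
    "homotopic_paths UNIV \<delta> (\<gamma> +++ \<eta>)"
    unfolding whisker_nbhd_def by blast
  obtain \<epsilon> where e: "path \<epsilon>" "path_image \<epsilon> \<subseteq> U" "pathstart \<epsilon> = pathfinish \<alpha>"
    "homotopic_paths UNIV \<gamma> (\<alpha> +++ \<epsilon>)"
    using path_class_in_whisker_nbhd[OF assms(1,2)] assms(3) by blast
  have f: "pathfinish \<epsilon> = pathstart \<eta>"
    using homotopic_paths_imp_pathfinish[OF e(4)] d(5) by simp
  note d(6)
  also have "homotopic_paths UNIV (\<gamma> +++ \<eta>) ((\<alpha> +++ \<epsilon>) +++ \<eta>)"
    using d e by (intro homotopic_paths_join) auto
  also have "homotopic_paths UNIV \<dots> (\<alpha> +++ (\<epsilon> +++ \<eta>))"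
    using d e f assms(1)
    by (intro homotopic_paths_sym[OF homotopic_paths_assoc]) (auto simp: paths_from_def)
  finally have "homotopic_paths UNIV \<delta> (\<alpha> +++ (\<epsilon> +++ \<eta>))" .
  moreover have "path_image (\<epsilon> +++ \<eta>) \<subseteq> U"
    using path_image_join_subset[of \<epsilon> \<eta>] d e assms(4) by blast
  ultimately show "c \<in> whisker_nbhd x0 U \<alpha>"
    using d(1,3) e f path_class_in_whisker_nbhd[OF assms(1) d(2)] path_join_imp[of \<epsilon> \<eta>]
    by (metis pathstart_join)
qed

lemma path_class_in_own_nbhd:
  assumes "\<alpha> \<in> paths_from x0" "pathfinish \<alpha> \<in> U"
  shows "path_class x0 \<alpha> \<in> whisker_nbhd x0 U \<alpha>"
  unfolding path_class_in_whisker_nbhd[OF assms(1,1)]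
  using assms homotopic_paths_sym[OF homotopic_paths_const_right, of \<alpha>]
  by (intro exI[of _ "\<lambda>_. pathfinish \<alpha>"])
     (auto simp: paths_from_def path_def path_image_def pathstart_def)

theorem openin_whisker_topology:
  "openin (whisker_topology x0) W \<longleftrightarrow> (\<exists>\<B>\<subseteq>whisker_basis x0. W = \<Union>\<B>)"
proof
  assume "openin (whisker_topology x0) W"
  then have "generate_topology_on (whisker_basis x0) W"
    unfolding whisker_topology_def by (rule openin_topology_generated_by)
  then show "\<exists>\<B>\<subseteq>whisker_basis x0. W = \<Union>\<B>"
  proof induction
    case Empty
    then show ?case by blast
  next
    case (Int A B)
    then obtain \<A> \<B> where AB: "\<A> \<subseteq> whisker_basis x0" "A = \<Union>\<A>" "\<B> \<subseteq> whisker_basis x0" "B = \<Union>\<B>"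
      by blast
    have "\<exists>N\<in>whisker_basis x0. c \<in> N \<and> N \<subseteq> A \<inter> B" if c: "c \<in> A \<inter> B" for c
    proof -
      from c AB obtain M N where MN: "M \<in> \<A>" "N \<in> \<B>" "c \<in> M" "c \<in> N" by blast
      have "M \<in> whisker_basis x0" "N \<in> whisker_basis x0" using MN AB by auto
      then obtain U \<alpha> V \<beta> where
        U: "M = whisker_nbhd x0 U \<alpha>" "\<alpha> \<in> paths_from x0" "open U" and
        V: "N = whisker_nbhd x0 V \<beta>" "\<beta> \<in> paths_from x0" "open V"
        unfolding whisker_basis_def by auto
      obtain \<gamma> where g: "c = path_class x0 \<gamma>" "\<gamma> \<in> paths_from x0"
        using MN(3) unfolding U(1) whisker_nbhd_def by blast
      have fin: "pathfinish \<gamma> \<in> S" if "c \<in> whisker_nbhd x0 S \<delta>" "\<delta> \<in> paths_from x0" for S \<delta>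
      proof -
        from that g obtain \<epsilon> where "path_image \<epsilon> \<subseteq> S" "homotopic_paths UNIV \<gamma> (\<delta> +++ \<epsilon>)"
          using path_class_in_whisker_nbhd by blast
        then show ?thesis using homotopic_paths_imp_pathfinish pathfinish_in_path_image
          by (metis pathfinish_join subsetD)
      qed
      have f: "pathfinish \<gamma> \<in> U \<inter> V" using fin MN U V by blast
      have "whisker_nbhd x0 (U \<inter> V) \<gamma> \<subseteq> M"
        unfolding U(1) using MN(3) U(1) g by (intro whisker_nbhd_subset[OF U(2) g(2)]) auto
      moreover have "whisker_nbhd x0 (U \<inter> V) \<gamma> \<subseteq> N"
        unfolding V(1) using MN(4) V(1) g by (intro whisker_nbhd_subset[OF V(2) g(2)]) auto
      moreover have "whisker_nbhd x0 (U \<inter> V) \<gamma> \<in> whisker_basis x0"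
        using f g U(3) V(3) unfolding whisker_basis_def by blast
      moreover have "c \<in> whisker_nbhd x0 (U \<inter> V) \<gamma>"
        unfolding g(1) using path_class_in_own_nbhd[OF g(2) f] .
      ultimately show ?thesis using MN AB by blast
    qed
    then show ?case by (intro exI[of _ "{N \<in> whisker_basis x0. N \<subseteq> A \<inter> B}"]) blast
  next
    case (UN K)
    have "\<exists>N\<in>whisker_basis x0. c \<in> N \<and> N \<subseteq> \<Union>K" if c: "c \<in> \<Union>K" for c
    proof -
      from c obtain k where k: "k \<in> K" "c \<in> k" by (rule UnionE)
      from UN[OF k(1)] obtain \<B> where "\<B> \<subseteq> whisker_basis x0" "k = \<Union>\<B>" by blast
      with k show ?thesis by blast
    qed
    then show ?case by (intro exI[of _ "{N \<in> whisker_basis x0. N \<subseteq> \<Union>K}"]) blast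
  next
    case (Basis s)
    then show ?case by (intro exI[of _ "{s}"]) auto
  qed
next
  assume "\<exists>\<B>\<subseteq>whisker_basis x0. W = \<Union>\<B>"
  then show "openin (whisker_topology x0) W"
    unfolding whisker_topology_def by (auto intro: topology_generated_by_Basis)
qed

lemma topspace_whisker_topology: "topspace (whisker_topology x0) = path_classes x0"
proof -
  have "c \<in> \<Union>(whisker_basis x0)" if c: "c \<in> path_classes x0" for c
  proof -
    from c obtain \<alpha> where a: "\<alpha> \<in> paths_from x0" "c = path_class x0 \<alpha>"
      by (auto simp: path_classes_def path_class_def quotient_def)
    then have "whisker_nbhd x0 UNIV \<alpha> \<in> whisker_basis x0"
      by (auto simp: whisker_basis_def)
    then show ?thesis using a path_class_in_own_nbhd[of \<alpha> x0 UNIV] by auto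
  qed
  moreover have "\<Union>(whisker_basis x0) \<subseteq> path_classes x0"
    by (auto simp: whisker_basis_def whisker_nbhd_def path_classes_def path_class_def quotient_def)
  ultimately show ?thesis
    unfolding whisker_topology_def topology_generated_by_topspace by blast
qed

lemma loop_class_to_fiber_bij:
  "bij_betw (loop_class_to_fiber x0) (carrier (fundamental_group x0)) (fiber x0)"
proof -
  have L: "loops_in UNIV x0 = {\<alpha> \<in> paths_from x0. pathfinish \<alpha> = x0}"
    by (auto simp: loops_in_def paths_from_def)
  have eq: "loop_rel x0 `` {\<alpha>} = path_class x0 \<alpha>" if "\<alpha> \<in> loops_in UNIV x0" for \<alpha>
    using that
    by (auto simp: loop_rel_def path_class_def path_rel_iff L paths_from_def
        dest: homotopic_paths_imp_path)
      (metis homotopic_paths_imp_pathstart homotopic_paths_imp_pathfinish)+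
  have img: "loop_class_to_fiber x0 (path_class x0 \<alpha>) = path_class x0 \<alpha>"
    if "\<alpha> \<in> loops_in UNIV x0" for \<alpha>
  proof -
    have a: "\<alpha> \<in> paths_from x0" using that L by auto
    have "path_class x0 \<beta> = path_class x0 \<alpha>" if "\<beta> \<in> path_class x0 \<alpha>" for \<beta>
      using that equiv_class_eq[OF equiv_path_rel] unfolding path_class_def by fastforce
    moreover have "\<alpha> \<in> path_class x0 \<alpha>"
      using equiv_class_self[OF equiv_path_rel a] by (simp add: path_class_def)
    ultimately have "(\<Union>\<beta>\<in>path_class x0 \<alpha>. path_class x0 \<beta>) = (\<Union>\<beta>\<in>path_class x0 \<alpha>. path_class x0 \<alpha>)"
      by (intro SUP_cong refl)
    with \<open>\<alpha> \<in> path_class x0 \<alpha>\<close> show ?thesis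
      unfolding loop_class_to_fiber_def UN_constant by (simp split: if_splits)
  qed
  have car: "carrier (fundamental_group x0) = path_class x0 ` loops_in UNIV x0"
    by (auto simp: fundamental_group_def quotient_def eq)
  have fib: "fiber x0 = path_class x0 ` loops_in UNIV x0"
  proof -
    have P: "path_classes x0 = path_class x0 ` paths_from x0"
      by (auto simp: path_classes_def quotient_def path_class_def)
    have mem: "c \<in> fiber x0 \<longleftrightarrow> c \<in> path_class x0 ` loops_in UNIV x0" for c
    proof
      assume "c \<in> fiber x0"
      then obtain \<alpha> where a: "\<alpha> \<in> paths_from x0" "c = path_class x0 \<alpha>" "endpoint c = x0"
        unfolding fiber_def P by auto
      then have "\<alpha> \<in> loops_in UNIV x0" using endpoint_path_class[OF a(1)] by (simp add: L)
      then show "c \<in> path_class x0 ` loops_in UNIV x0" unfolding a(2) by (rule imageI)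
    next
      assume "c \<in> path_class x0 ` loops_in UNIV x0"
      then obtain \<alpha> where c: "c = path_class x0 \<alpha>" and l: "\<alpha> \<in> loops_in UNIV x0"
        by (rule imageE)
      from l have a: "\<alpha> \<in> paths_from x0" "pathfinish \<alpha> = x0" by (simp_all add: L)
      from c show "c \<in> fiber x0"
        unfolding fiber_def P using endpoint_path_class[OF a(1)] a by simp
    qed
    show ?thesis using mem by (simp add: set_eq_iff)
  qed
  have id: "loop_class_to_fiber x0 c = c" if "c \<in> path_class x0 ` loops_in UNIV x0" for c
    using that by (rule imageE) (simp add: img)
  then have "inj_on (loop_class_to_fiber x0) (path_class x0 ` loops_in UNIV x0)"
    by (rule inj_on_inverseI)
  moreover have "loop_class_to_fiber x0 ` path_class x0 ` loops_in UNIV x0 =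
      path_class x0 ` loops_in UNIV x0"
    unfolding image_image by (intro image_cong refl img)
  ultimately show ?thesis unfolding car fib bij_betw_def ..
qed

end

theory Submission
  imports Defs "HOL-Algebra.Coset"
begin

text \<open>The classes of loops in an open neighbourhood \<open>U\<close> of \<open>x0\<close> form a subgroup \<open>H\<^sub>U\<close> of the
  fundamental group, and the whisker topology on the fiber is the one in which the left cosets
  \<open>g H\<^sub>U\<close> form a neighbourhood basis at \<open>g\<close>. Left translations are always continuous, so the only
  obstruction to being a topological group is conjugation: multiplication is continuous if for
  all \<open>g\<close> and \<open>U\<close> there is \<open>V\<close> with \<open>g H\<^sub>V g\<^sup>-\<^sup>1 \<subseteq> H\<^sub>U\<close>, and continuity of inversion at \<open>g\<close> forces
  such a \<open>V\<close> to exist. This condition on \<open>g\<close> is the SLT property of its representatives.\<close>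

subsection \<open>Group topologies defined by a family of subgroups\<close>

text \<open>The part of the argument that involves no paths. Inversion maps \<open>g <# K\<close>
  into \<open>inv g <# H\<close> exactly when conjugation by \<open>g\<close> maps \<open>K\<close>
  into \<open>H\<close>, up to inverting elements of \<open>H\<close>. For products, x K y H = (x
  y)(inv y K y) H, so a factor from \<open>K\<close> has to be moved past \<open>y\<close>.\<close>

lemma (in group) topological_group_subgroup_family_iff:
  assumes sub: "\<And>H. H \<in> \<H> \<Longrightarrow> subgroup H G" and ne: "\<H> \<noteq> {}"
    and op: "\<And>W. openin T W \<longleftrightarrow> W \<subseteq> carrier G \<and> (\<forall>g\<in>W. \<exists>H\<in>\<H>. g <# H \<subseteq> W)"
  shows "topological_group G T \<longleftrightarrow>
    (\<forall>g\<in>carrier G. \<forall>H\<in>\<H>. \<exists>K\<in>\<H>. \<forall>k\<in>K. g \<otimes> k \<otimes> inv g \<in> H)"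
proof -
  have mem: "h \<in> carrier G" if "h \<in> H" "H \<in> \<H>" for h H
    using subgroup.mem_carrier[OF sub] that by blast
  have coset_carrier: "g <# H \<subseteq> carrier G" if "g \<in> carrier G" "H \<in> \<H>" for g H
    using that mem by (auto simp: l_coset_def)
  have coset_self: "g \<in> g <# H" if "g \<in> carrier G" "H \<in> \<H>" for g H
    using that subgroup.one_closed[OF sub] by (force simp: l_coset_def)
  \<comment> \<open>The same \<open>H\<close> serves at every point of the coset, because
    \<open>x\<close> in \<open>g <# H\<close> gives
    \<open>x <# H \<subseteq> g <# H\<close>.\<close>
  have coset_open: "openin T (g <# H)" if g: "g \<in> carrier G" and H: "H \<in> \<H>" for g H
    unfolding op
  proof (intro conjI ballI bexI[OF _ H])
    show "g <# H \<subseteq> carrier G" by (rule coset_carrier[OF g H])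
    fix x assume "x \<in> g <# H"
    then obtain h where h: "h \<in> H" "x = g \<otimes> h" by (auto simp: l_coset_def)
    show "x <# H \<subseteq> g <# H"
    proof
      fix y assume "y \<in> x <# H"
      then obtain k where k: "k \<in> H" "y = x \<otimes> k" by (auto simp: l_coset_def)
      then have "y = g \<otimes> (h \<otimes> k)" using h g mem[OF _ H] by (simp add: m_assoc)
      then show "y \<in> g <# H"
        using subgroup.m_closed[OF sub[OF H] h(1) k(1)] by (auto simp: l_coset_def)
    qed
  qed
  have top: "topspace T = carrier G"
  proof
    show "topspace T \<subseteq> carrier G" using op openin_topspace by blast
    \<comment> \<open>Since the family is nonempty, every point of the carrier has a coset around it
      as demanded by \<open>op\<close>, so the carrier is open.\<close>
    show "carrier G \<subseteq> topspace T"
      using ne coset_carrier by (intro openin_subset) (auto simp: op)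
  qed
  show ?thesis
  proof
    assume tg: "topological_group G T"
    show "\<forall>g\<in>carrier G. \<forall>H\<in>\<H>. \<exists>K\<in>\<H>. \<forall>k\<in>K. g \<otimes> k \<otimes> inv g \<in> H"
    proof (intro ballI)
      fix g H assume g: "g \<in> carrier G" and H: "H \<in> \<H>"
      \<comment> \<open>Inversion sends \<open>g\<close> to \<open>inv g\<close>, so the preimage of
        the open coset \<open>inv g <# H\<close> is a neighbourhood of \<open>g\<close> and contains
        some \<open>g <# K\<close>.\<close>
      have "openin T {x \<in> topspace T. inv x \<in> inv g <# H}"
        using tg coset_open[OF inv_closed[OF g] H] openin_continuous_map_preimage
        unfolding topological_group_def by blast
      moreover have "g \<in> {x \<in> topspace T. inv x \<in> inv g <# H}"
        using g H top coset_self by simp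
      ultimately obtain K where K: "K \<in> \<H>" "g <# K \<subseteq> {x \<in> topspace T. inv x \<in> inv g <# H}"
        unfolding op by blast
      have "g \<otimes> k \<otimes> inv g \<in> H" if k: "k \<in> K" for k
      proof -
        have kc: "k \<in> carrier G" using mem k K(1) by blast
        have "inv (g \<otimes> k) \<in> inv g <# H" using k K(2) by (auto simp: l_coset_def)
        then obtain h where h: "h \<in> H" "inv (g \<otimes> k) = inv g \<otimes> h" by (auto simp: l_coset_def)
        have hc: "h \<in> carrier G" using mem h H by blast
        \<comment> \<open>The element \<open>h\<close> turns out to be the inverse of the conjugate
          of \<open>k\<close>, and \<open>H\<close> is closed under inverses.\<close>
        have "h = g \<otimes> inv (g \<otimes> k)"
          unfolding h(2) using g hc by (simp add: m_assoc[symmetric])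
        then have "inv h = g \<otimes> k \<otimes> inv g"
          using g kc by (simp add: inv_mult_group)
        then show ?thesis using subgroup.m_inv_closed[OF sub[OF H] h(1)] by simp
      qed
      then show "\<exists>K\<in>\<H>. \<forall>k\<in>K. g \<otimes> k \<otimes> inv g \<in> H" using K(1) by blast
    qed
  next
    assume conj: "\<forall>g\<in>carrier G. \<forall>H\<in>\<H>. \<exists>K\<in>\<H>. \<forall>k\<in>K. g \<otimes> k \<otimes> inv g \<in> H"
    have "continuous_map (prod_topology T T) T (\<lambda>(x, y). x \<otimes> y)"
      unfolding continuous_map_def
    proof (intro conjI allI impI)
      show "(\<lambda>(x, y). x \<otimes> y) \<in> topspace (prod_topology T T) \<rightarrow> topspace T"
        by (auto simp: top)
      fix W assume W: "openin T W"
      let ?P = "{z \<in> topspace (prod_topology T T). (case z of (x, y) \<Rightarrow> x \<otimes> y) \<in> W}"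
      have "\<exists>A B. openin T A \<and> openin T B \<and> x \<in> A \<and> y \<in> B \<and> A \<times> B \<subseteq> ?P"
        if "(x, y) \<in> ?P" for x y
      proof -
        have xy: "x \<in> carrier G" "y \<in> carrier G" "x \<otimes> y \<in> W" using that top by auto
        obtain H where H: "H \<in> \<H>" "(x \<otimes> y) <# H \<subseteq> W" using xy(3) W op by blast
        \<comment> \<open>The condition is applied to \<open>inv y\<close>, since \<open>k\<close>
          has to pass from the left of \<open>y\<close> to its right.\<close>
        obtain K where K: "K \<in> \<H>" "\<And>k. k \<in> K \<Longrightarrow> inv y \<otimes> k \<otimes> y \<in> H"
          using conj H(1) xy(2) by (metis inv_closed inv_inv)
        have "a \<otimes> b \<in> W" if ab: "a \<in> x <# K" "b \<in> y <# H" for a b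
        proof -
          obtain k h where kh: "k \<in> K" "a = x \<otimes> k" "h \<in> H" "b = y \<otimes> h"
            using ab by (auto simp: l_coset_def)
          have c: "k \<in> carrier G" "h \<in> carrier G" using mem kh K(1) H(1) by blast+
          have "y \<otimes> (inv y \<otimes> (k \<otimes> (y \<otimes> h))) = k \<otimes> (y \<otimes> h)"
            using c xy by (simp add: m_assoc[symmetric])
          then have "a \<otimes> b = (x \<otimes> y) \<otimes> ((inv y \<otimes> k \<otimes> y) \<otimes> h)"
            using c xy kh by (simp add: m_assoc)
          moreover have "(inv y \<otimes> k \<otimes> y) \<otimes> h \<in> H"
            using K(2) kh subgroup.m_closed[OF sub[OF H(1)]] by blast
          ultimately show ?thesis using H(2) by (auto simp: l_coset_def)
        qed
        then have "(x <# K) \<times> (y <# H) \<subseteq> ?P"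
          using coset_carrier[OF xy(1) K(1)] coset_carrier[OF xy(2) H(1)] by (auto simp: top)
        then show ?thesis
          using coset_open[OF xy(1) K(1)] coset_open[OF xy(2) H(1)]
            coset_self[OF xy(1) K(1)] coset_self[OF xy(2) H(1)]
          by (intro exI[of _ "x <# K"] exI[of _ "y <# H"] conjI)
      qed
      then show "openin (prod_topology T T) ?P"
        unfolding openin_prod_topology_alt by blast
    qed
    moreover have "continuous_map T T (\<lambda>x. inv x)"
      unfolding continuous_map_def
    proof (intro conjI allI impI)
      show "(\<lambda>x. inv x) \<in> topspace T \<rightarrow> topspace T" by (auto simp: top)
      fix W assume W: "openin T W"
      let ?P = "{x \<in> topspace T. inv x \<in> W}"
      have "\<exists>K\<in>\<H>. x <# K \<subseteq> ?P" if "x \<in> ?P" for x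
      proof -
        have x: "x \<in> carrier G" "inv x \<in> W" using that top by auto
        obtain H where H: "H \<in> \<H>" "inv x <# H \<subseteq> W" using x(2) W op by blast
        \<comment> \<open>Here the condition is applied to \<open>x\<close> itself: the inverse of
          \<open>x \<otimes> k\<close> is \<open>inv x\<close> times the conjugate of
          \<open>inv k\<close> by \<open>x\<close>.\<close>
        obtain K where K: "K \<in> \<H>" "\<And>k. k \<in> K \<Longrightarrow> x \<otimes> k \<otimes> inv x \<in> H"
          using conj H(1) x(1) by blast
        have "inv (x \<otimes> k) \<in> W" if k: "k \<in> K" for k
        proof -
          have c: "k \<in> carrier G" using mem k K(1) by blast
          have "inv x \<otimes> (x \<otimes> (inv k \<otimes> inv x)) = inv k \<otimes> inv x"
            using c x(1) by (simp add: m_assoc[symmetric])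
          then have "inv (x \<otimes> k) = inv x \<otimes> (x \<otimes> inv k \<otimes> inv x)"
            using c x(1) by (simp add: inv_mult_group m_assoc)
          moreover have "x \<otimes> inv k \<otimes> inv x \<in> H"
            using K(2) subgroup.m_inv_closed[OF sub[OF K(1)] k] by blast
          ultimately show ?thesis using H(2) by (auto simp: l_coset_def)
        qed
        then have "x <# K \<subseteq> ?P"
          using coset_carrier[OF x(1) K(1)] by (auto simp: top l_coset_def)
        then show ?thesis using K(1) by blast
      qed
      then show "openin T ?P" unfolding op by (auto simp: top)
    qed
    ultimately show "topological_group G T"
      unfolding topological_group_def using top is_group by blast
  qed
qed

subsection \<open>The group structure on the fiber\<close>

lemma loops_in_UNIV_iff: "\<alpha> \<in> loops_in UNIV x0 \<longleftrightarrow> \<alpha> \<in> paths_from x0 \<and> pathfinish \<alpha> = x0"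
  by (auto simp: loops_in_def paths_from_def)

lemma loops_in_mono: "U \<subseteq> V \<Longrightarrow> loops_in U x \<subseteq> loops_in V x"
  by (auto simp: loops_in_def)

lemma loops_in_UNIV: "\<alpha> \<in> loops_in U x \<Longrightarrow> \<alpha> \<in> loops_in UNIV x"
  using loops_in_mono[of U UNIV] by blast

lemma const_in_loops_in: "x \<in> U \<Longrightarrow> (\<lambda>_. x) \<in> loops_in U x"
  by (auto simp: loops_in_def path_def path_image_def pathstart_def pathfinish_def)

lemma join_in_loops_in: "\<alpha> \<in> loops_in U x \<Longrightarrow> \<beta> \<in> loops_in U x \<Longrightarrow> \<alpha> +++ \<beta> \<in> loops_in U x"
  by (auto simp: loops_in_def path_image_join)

lemma reversepath_in_loops_in: "\<alpha> \<in> loops_in U x \<Longrightarrow> reversepath \<alpha> \<in> loops_in U x"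
  by (auto simp: loops_in_def)

lemma path_class_loop_eq_iff:
  assumes "\<alpha> \<in> loops_in UNIV x0" "\<beta> \<in> loops_in UNIV x0"
  shows "path_class x0 \<alpha> = path_class x0 \<beta> \<longleftrightarrow> homotopic_paths UNIV \<alpha> \<beta>"
  using assms path_class_eq_iff unfolding loops_in_UNIV_iff by blast

text \<open>A path homotopic to a loop rel endpoints is a loop at the same point, so both relations
  have the same class at a loop. Elements of the fundamental group and of the fiber are therefore
  literally the same sets.\<close>

lemma loop_rel_image:
  assumes "\<alpha> \<in> loops_in UNIV x0"
  shows "loop_rel x0 `` {\<alpha>} = path_class x0 \<alpha>"
proof -
  have "\<beta> \<in> loops_in UNIV x0" if "homotopic_paths UNIV \<alpha> \<beta>" for \<beta>
    using assms homotopic_paths_imp_path[OF that] homotopic_paths_imp_pathstart[OF that]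
      homotopic_paths_imp_pathfinish[OF that] by (simp add: loops_in_def)
  then have "(\<alpha>, \<beta>) \<in> loop_rel x0 \<longleftrightarrow> (\<alpha>, \<beta>) \<in> path_rel x0" for \<beta>
    using assms by (auto simp: loop_rel_def path_rel_iff loops_in_UNIV_iff)
  then show ?thesis by (auto simp: path_class_def)
qed

lemma mem_path_class_loop:
  assumes "\<alpha> \<in> loops_in UNIV x0"
  shows "\<beta> \<in> path_class x0 \<alpha> \<longleftrightarrow> \<beta> \<in> loops_in UNIV x0 \<and> homotopic_paths UNIV \<alpha> \<beta>"
  unfolding loop_rel_image[OF assms, symmetric] using assms by (auto simp: loop_rel_def)

lemma carrier_fundamental_group:
  "carrier (fundamental_group x0) = path_class x0 ` loops_in UNIV x0"
  by (auto simp: fundamental_group_def quotient_def loop_rel_image)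

text \<open>All members of the union coincide and the union is nonempty. The bijection that
  transports the group structure is thus the identity on loop classes.\<close>

lemma loop_class_to_fiber_path_class:
  assumes a: "\<alpha> \<in> loops_in UNIV x0"
  shows "loop_class_to_fiber x0 (path_class x0 \<alpha>) = path_class x0 \<alpha>"
proof -
  have "path_class x0 \<beta> = path_class x0 \<alpha>" if "\<beta> \<in> path_class x0 \<alpha>" for \<beta>
    using that a path_class_loop_eq_iff[of \<alpha> x0 \<beta>] mem_path_class_loop[OF a] by simp
  moreover have "\<alpha> \<in> path_class x0 \<alpha>"
    using a by (simp add: mem_path_class_loop) (simp add: loops_in_def)
  ultimately show ?thesis unfolding loop_class_to_fiber_def by blast
qed

lemma fiber_eq: "fiber x0 = path_class x0 ` loops_in UNIV x0"
proof -
  have "fiber x0 = loop_class_to_fiber x0 ` path_class x0 ` loops_in UNIV x0"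
    using loop_class_to_fiber_bij[of x0]
    by (simp add: bij_betw_def carrier_fundamental_group)
  then show ?thesis by (simp add: image_image loop_class_to_fiber_path_class)
qed

text \<open>The product is a union over all pairs of representatives. Homotopy invariance of
  concatenation makes its members equal, and the pair \<open>\<alpha>\<close>,
  \<open>\<beta>\<close> shows that it is nonempty.\<close>

lemma fundamental_group_mult:
  assumes a: "\<alpha> \<in> loops_in UNIV x0" and b: "\<beta> \<in> loops_in UNIV x0"
  shows "path_class x0 \<alpha> \<otimes>\<^bsub>fundamental_group x0\<^esub> path_class x0 \<beta> = path_class x0 (\<alpha> +++ \<beta>)"
proof -
  have eq: "loop_rel x0 `` {\<alpha>' +++ \<beta>'} = path_class x0 (\<alpha> +++ \<beta>)"
    if "\<alpha>' \<in> path_class x0 \<alpha>" "\<beta>' \<in> path_class x0 \<beta>" for \<alpha>' \<beta>'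
  proof -
    have *: "\<alpha>' \<in> loops_in UNIV x0" "\<beta>' \<in> loops_in UNIV x0"
      "homotopic_paths UNIV \<alpha> \<alpha>'" "homotopic_paths UNIV \<beta> \<beta>'"
      using that by (auto simp: mem_path_class_loop a b)
    have "homotopic_paths UNIV (\<alpha> +++ \<beta>) (\<alpha>' +++ \<beta>')"
      using * a b by (intro homotopic_paths_join) (auto simp: loops_in_def)
    then have "path_class x0 (\<alpha> +++ \<beta>) = path_class x0 (\<alpha>' +++ \<beta>')"
      using * a b by (simp add: path_class_loop_eq_iff join_in_loops_in)
    then show ?thesis using * by (simp add: loop_rel_image join_in_loops_in)
  qed
  have "\<alpha> \<in> path_class x0 \<alpha>" "\<beta> \<in> path_class x0 \<beta>"
    using a b by (simp_all add: mem_path_class_loop) (simp_all add: loops_in_def)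
  then show ?thesis using eq by (simp add: fundamental_group_def) blast
qed

lemma fiber_group_carrier [simp]: "carrier (fiber_group x0) = fiber x0"
  by (simp add: fiber_group_def Let_def)

lemma fiber_group_one: "\<one>\<^bsub>fiber_group x0\<^esub> = path_class x0 (\<lambda>_. x0)"
  using const_in_loops_in[of x0 UNIV]
  by (simp add: fiber_group_def Let_def fundamental_group_def loop_rel_image
      loop_class_to_fiber_path_class)

text \<open>Both the transporting bijection and its inverse fix loop classes, so the product formula
  carries over from the fundamental group.\<close>

lemma fiber_group_mult:
  assumes a: "\<alpha> \<in> loops_in UNIV x0" and b: "\<beta> \<in> loops_in UNIV x0"
  shows "path_class x0 \<alpha> \<otimes>\<^bsub>fiber_group x0\<^esub> path_class x0 \<beta> = path_class x0 (\<alpha> +++ \<beta>)"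
proof -
  let ?G = "fundamental_group x0"
  have inv: "inv_into (carrier ?G) (loop_class_to_fiber x0) (path_class x0 \<gamma>) = path_class x0 \<gamma>"
    if "\<gamma> \<in> loops_in UNIV x0" for \<gamma>
    using loop_class_to_fiber_bij[of x0] that
    by (intro inv_into_f_eq) (auto simp: bij_betw_def carrier_fundamental_group
        loop_class_to_fiber_path_class)
  show ?thesis
    by (simp add: fiber_group_def Let_def inv a b fundamental_group_mult
        loop_class_to_fiber_path_class join_in_loops_in)
qed

lemma fiber_group_mult_reversepath:
  assumes a: "\<alpha> \<in> loops_in UNIV x0"
  shows "path_class x0 (reversepath \<alpha>) \<otimes>\<^bsub>fiber_group x0\<^esub> path_class x0 \<alpha> = \<one>\<^bsub>fiber_group x0\<^esub>"
proof -
  have "homotopic_paths UNIV (reversepath \<alpha> +++ \<alpha>) (\<lambda>_. x0)"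
    using homotopic_paths_reverse_left[of \<alpha>] a by (simp add: loops_in_def)
  then show ?thesis
    using a by (simp add: fiber_group_mult fiber_group_one path_class_loop_eq_iff
        reversepath_in_loops_in join_in_loops_in const_in_loops_in)
qed

text \<open>The laws are checked on representatives; \<open>groupI\<close> asks for a left unit and
  left inverses.\<close>

lemma group_fiber_group: "group (fiber_group x0)"
proof (rule groupI)
  fix x y assume "x \<in> carrier (fiber_group x0)" "y \<in> carrier (fiber_group x0)"
  then show "x \<otimes>\<^bsub>fiber_group x0\<^esub> y \<in> carrier (fiber_group x0)"
    by (auto simp: fiber_eq fiber_group_mult join_in_loops_in)
next
  show "\<one>\<^bsub>fiber_group x0\<^esub> \<in> carrier (fiber_group x0)"
    by (simp add: fiber_eq fiber_group_one const_in_loops_in)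
next
  fix x y z
  assume "x \<in> carrier (fiber_group x0)" "y \<in> carrier (fiber_group x0)"
    "z \<in> carrier (fiber_group x0)"
  then obtain \<alpha> \<beta> \<gamma> where *: "\<alpha> \<in> loops_in UNIV x0" "\<beta> \<in> loops_in UNIV x0" "\<gamma> \<in> loops_in UNIV x0"
    "x = path_class x0 \<alpha>" "y = path_class x0 \<beta>" "z = path_class x0 \<gamma>"
    by (auto simp: fiber_eq)
  have "homotopic_paths UNIV ((\<alpha> +++ \<beta>) +++ \<gamma>) (\<alpha> +++ (\<beta> +++ \<gamma>))"
    using * by (intro homotopic_paths_sym[OF homotopic_paths_assoc]) (auto simp: loops_in_def)
  then show "x \<otimes>\<^bsub>fiber_group x0\<^esub> y \<otimes>\<^bsub>fiber_group x0\<^esub> z =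
      x \<otimes>\<^bsub>fiber_group x0\<^esub> (y \<otimes>\<^bsub>fiber_group x0\<^esub> z)"
    using * by (simp add: fiber_group_mult join_in_loops_in path_class_loop_eq_iff)
next
  fix x assume "x \<in> carrier (fiber_group x0)"
  then obtain \<alpha> where a: "\<alpha> \<in> loops_in UNIV x0" "x = path_class x0 \<alpha>"
    by (auto simp: fiber_eq)
  have "homotopic_paths UNIV ((\<lambda>_. x0) +++ \<alpha>) \<alpha>"
    using homotopic_paths_const_left[of \<alpha>] a by (simp add: loops_in_def)
  then show "\<one>\<^bsub>fiber_group x0\<^esub> \<otimes>\<^bsub>fiber_group x0\<^esub> x = x"
    using a by (simp add: fiber_group_mult fiber_group_one path_class_loop_eq_iff
        join_in_loops_in const_in_loops_in)
  show "\<exists>y\<in>carrier (fiber_group x0). y \<otimes>\<^bsub>fiber_group x0\<^esub> x = \<one>\<^bsub>fiber_group x0\<^esub>"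
    using a by (auto simp: fiber_eq intro!: bexI[of _ "reversepath \<alpha>"]
        fiber_group_mult_reversepath reversepath_in_loops_in)
qed

lemma fiber_group_inv:
  assumes a: "\<alpha> \<in> loops_in UNIV x0"
  shows "inv\<^bsub>fiber_group x0\<^esub> (path_class x0 \<alpha>) = path_class x0 (reversepath \<alpha>)"
  using a fiber_group_mult_reversepath[OF a]
  by (intro group.inv_equality[OF group_fiber_group])
     (auto simp: fiber_eq reversepath_in_loops_in)

subsection \<open>Classes of small loops\<close>

text \<open>For \<open>x0\<close> in \<open>U\<close> this is the image of the fundamental group of
  \<open>U\<close> under the map induced by inclusion: the loops stay in \<open>U\<close>, while
  homotopies may use the whole space.\<close>

definition small_loop_classes ::
  "'a::topological_space \<Rightarrow> 'a set \<Rightarrow> (real \<Rightarrow> 'a) set set" where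
  "small_loop_classes x0 U = path_class x0 ` loops_in U x0"

lemma subgroup_small_loop_classes:
  assumes "x0 \<in> U"
  shows "subgroup (small_loop_classes x0 U) (fiber_group x0)"
proof (rule group.subgroupI[OF group_fiber_group])
  show "small_loop_classes x0 U \<subseteq> carrier (fiber_group x0)"
    using loops_in_mono[of U UNIV] by (auto simp: small_loop_classes_def fiber_eq)
  show "small_loop_classes x0 U \<noteq> {}"
    using const_in_loops_in[OF assms] by (auto simp: small_loop_classes_def)
  fix a assume "a \<in> small_loop_classes x0 U"
  then show "inv\<^bsub>fiber_group x0\<^esub> a \<in> small_loop_classes x0 U"
    by (auto simp: small_loop_classes_def fiber_group_inv loops_in_UNIV reversepath_in_loops_in)
next
  fix a b assume "a \<in> small_loop_classes x0 U" "b \<in> small_loop_classes x0 U"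
  then show "a \<otimes>\<^bsub>fiber_group x0\<^esub> b \<in> small_loop_classes x0 U"
    by (auto simp: small_loop_classes_def fiber_group_mult loops_in_UNIV join_in_loops_in)
qed

section \<open>The whisker topology on the fiber in terms of cosets\<close>

text \<open>A whisker attached to a loop leads back into the fiber exactly when it is itself a loop
  at \<open>x0\<close>. Whiskers are appended at the end, hence left cosets.\<close>

lemma whisker_nbhd_Int_fiber:
  assumes a: "\<alpha> \<in> loops_in UNIV x0"
  shows "whisker_nbhd x0 U \<alpha> \<inter> fiber x0 =
    path_class x0 \<alpha> <#\<^bsub>fiber_group x0\<^esub> small_loop_classes x0 U"
proof (intro equalityI subsetI)
  have ap: "\<alpha> \<in> paths_from x0" "pathfinish \<alpha> = x0" using a by (auto simp: loops_in_UNIV_iff)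
  fix c assume c: "c \<in> whisker_nbhd x0 U \<alpha> \<inter> fiber x0"
  then obtain \<beta> where b: "\<beta> \<in> loops_in UNIV x0" "c = path_class x0 \<beta>" by (auto simp: fiber_eq)
  then have "\<beta> \<in> paths_from x0" by (simp add: loops_in_UNIV_iff)
  then obtain \<epsilon> where e: "path \<epsilon>" "path_image \<epsilon> \<subseteq> U" "pathstart \<epsilon> = x0"
    "homotopic_paths UNIV \<beta> (\<alpha> +++ \<epsilon>)"
    using path_class_in_whisker_nbhd[OF ap(1)] c b(2) ap(2) by auto
  \<comment> \<open>The homotopy fixes endpoints, so the whisker ends where the loop
    \<open>\<beta>\<close> does and closes up.\<close>
  have "pathfinish \<epsilon> = x0"
    using homotopic_paths_imp_pathfinish[OF e(4)] b(1) by (simp add: loops_in_def)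
  then have eU: "\<epsilon> \<in> loops_in U x0" using e by (simp add: loops_in_def)
  then have "c = path_class x0 \<alpha> \<otimes>\<^bsub>fiber_group x0\<^esub> path_class x0 \<epsilon>"
    using a b e(4) by (simp add: fiber_group_mult path_class_loop_eq_iff join_in_loops_in
        loops_in_UNIV)
  then show "c \<in> path_class x0 \<alpha> <#\<^bsub>fiber_group x0\<^esub> small_loop_classes x0 U"
    using eU by (auto simp: l_coset_def small_loop_classes_def)
next
  have ap: "\<alpha> \<in> paths_from x0" "pathfinish \<alpha> = x0" using a by (auto simp: loops_in_UNIV_iff)
  fix c assume "c \<in> path_class x0 \<alpha> <#\<^bsub>fiber_group x0\<^esub> small_loop_classes x0 U"
  then obtain \<epsilon> where e: "\<epsilon> \<in> loops_in U x0" "c = path_class x0 (\<alpha> +++ \<epsilon>)"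
    using a by (auto simp: l_coset_def small_loop_classes_def fiber_group_mult loops_in_UNIV)
  have l: "\<alpha> +++ \<epsilon> \<in> loops_in UNIV x0" using a e(1) by (simp add: join_in_loops_in loops_in_UNIV)
  then have "\<alpha> +++ \<epsilon> \<in> paths_from x0" "homotopic_paths UNIV (\<alpha> +++ \<epsilon>) (\<alpha> +++ \<epsilon>)"
    by (simp_all add: loops_in_UNIV_iff) (simp add: paths_from_def)
  then have "c \<in> whisker_nbhd x0 U \<alpha>"
    unfolding e(2) using e(1) ap path_class_in_whisker_nbhd[OF ap(1), of "\<alpha> +++ \<epsilon>"]
    by (auto simp: loops_in_def)
  then show "c \<in> whisker_nbhd x0 U \<alpha> \<inter> fiber x0" using l e(2) by (auto simp: fiber_eq)
qed

text \<open>Ensures that a basis set meeting the fiber comes from a neighbourhood of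
  \<open>x0\<close>, even if its centre is a path ending elsewhere.\<close>

lemma pathfinish_in_whisker_nbhd:
  assumes "\<alpha> \<in> paths_from x0" "\<beta> \<in> paths_from x0" "path_class x0 \<beta> \<in> whisker_nbhd x0 U \<alpha>"
  shows "pathfinish \<beta> \<in> U"
proof -
  obtain \<epsilon> where "path_image \<epsilon> \<subseteq> U" "homotopic_paths UNIV \<beta> (\<alpha> +++ \<epsilon>)"
    using assms path_class_in_whisker_nbhd by blast
  then show ?thesis
    using homotopic_paths_imp_pathfinish[of UNIV \<beta>] pathfinish_in_path_image[of \<epsilon>] by auto
qed

text \<open>Puts the fiber topology into the form of the hypothesis \<open>op\<close> of
  \<open>topological_group_subgroup_family_iff\<close>.\<close>

lemma openin_fiber_topology_iff:
  "openin (fiber_topology x0) W \<longleftrightarrow> W \<subseteq> carrier (fiber_group x0) \<and>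
    (\<forall>g\<in>W. \<exists>H\<in>small_loop_classes x0 ` {U. open U \<and> x0 \<in> U}. g <#\<^bsub>fiber_group x0\<^esub> H \<subseteq> W)"
  (is "_ \<longleftrightarrow> ?R")
proof
  assume "openin (fiber_topology x0) W"
  then obtain \<B> where B: "\<B> \<subseteq> whisker_basis x0" "W = \<Union>\<B> \<inter> fiber x0"
    unfolding fiber_topology_def openin_subtopology openin_whisker_topology by blast
  have "\<exists>U. open U \<and> x0 \<in> U \<and> g <#\<^bsub>fiber_group x0\<^esub> small_loop_classes x0 U \<subseteq> W"
    if g: "g \<in> W" for g
  proof -
    obtain \<alpha> where a: "\<alpha> \<in> loops_in UNIV x0" "g = path_class x0 \<alpha>"
      using g B(2) by (auto simp: fiber_eq)
    have ap: "\<alpha> \<in> paths_from x0" "pathfinish \<alpha> = x0" using a by (auto simp: loops_in_UNIV_iff)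
    obtain N where N: "N \<in> \<B>" "g \<in> N" using g B(2) by blast
    then have "N \<in> whisker_basis x0" using B(1) by blast
    then obtain U \<beta> where U: "N = whisker_nbhd x0 U \<beta>" "\<beta> \<in> paths_from x0" "open U"
      unfolding whisker_basis_def by blast
    have gN: "path_class x0 \<alpha> \<in> whisker_nbhd x0 U \<beta>" using N(2) U(1) a(2) by simp
    have "x0 \<in> U" using pathfinish_in_whisker_nbhd[OF U(2) ap(1) gN] ap(2) by simp
    \<comment> \<open>The centre moves from \<open>\<beta>\<close>, which may fail to be a loop, to
      the loop \<open>\<alpha>\<close>, where the coset description applies.\<close>
    moreover have "whisker_nbhd x0 U \<alpha> \<subseteq> N"
      unfolding U(1) by (rule whisker_nbhd_subset[OF U(2) ap(1) gN order_refl])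
    then have "g <#\<^bsub>fiber_group x0\<^esub> small_loop_classes x0 U \<subseteq> W"
      unfolding a(2) whisker_nbhd_Int_fiber[OF a(1), symmetric] B(2) using N(1) by blast
    ultimately show ?thesis using U(3) by blast
  qed
  then show ?R using B(2) by auto
next
  assume R: ?R
  \<comment> \<open>Basis sets may reach outside the fiber, so only their traces on it are required
    to lie in \<open>W\<close>.\<close>
  let ?\<B> = "{N \<in> whisker_basis x0. N \<inter> fiber x0 \<subseteq> W}"
  have "g \<in> \<Union>?\<B>" if g: "g \<in> W" for g
  proof -
    obtain \<alpha> where a: "\<alpha> \<in> loops_in UNIV x0" "g = path_class x0 \<alpha>"
      using g R by (auto simp: fiber_eq)
    have ap: "\<alpha> \<in> paths_from x0" "pathfinish \<alpha> = x0" using a by (auto simp: loops_in_UNIV_iff)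
    obtain U where U: "open U" "x0 \<in> U" "g <#\<^bsub>fiber_group x0\<^esub> small_loop_classes x0 U \<subseteq> W"
      using R g by blast
    have "whisker_nbhd x0 U \<alpha> \<inter> fiber x0 \<subseteq> W"
      using U(3) unfolding a(2) whisker_nbhd_Int_fiber[OF a(1)] .
    moreover have "whisker_nbhd x0 U \<alpha> \<in> whisker_basis x0"
      using U ap unfolding whisker_basis_def by blast
    moreover have "g \<in> whisker_nbhd x0 U \<alpha>"
      unfolding a(2) using ap U(2) by (intro path_class_in_own_nbhd) auto
    ultimately show ?thesis by blast
  qed
  then have "W = \<Union>?\<B> \<inter> fiber x0" using R by auto
  moreover have "openin (whisker_topology x0) (\<Union>?\<B>)"
    unfolding openin_whisker_topology by (intro exI[of _ ?\<B>] conjI refl) auto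
  ultimately show "openin (fiber_topology x0) W"
    unfolding fiber_topology_def openin_subtopology by blast
qed

section \<open>Small loop transfer as a condition on conjugation\<close>

text \<open>For a loop both neighbourhoods are taken at \<open>x0\<close>, the transferred loop
  represents a conjugate, and being homotopic to a loop in \<open>U\<close> means that its class
  lies in \<open>small_loop_classes x0 U\<close>.\<close>

lemma SLT_path_loop_iff:
  assumes a: "\<alpha> \<in> loops_in UNIV x0"
  shows "SLT_path \<alpha> \<longleftrightarrow> (\<forall>U. open U \<and> x0 \<in> U \<longrightarrow> (\<exists>V. open V \<and> x0 \<in> V \<and>
    (\<forall>k\<in>small_loop_classes x0 V. path_class x0 \<alpha> \<otimes>\<^bsub>fiber_group x0\<^esub> k
       \<otimes>\<^bsub>fiber_group x0\<^esub> inv\<^bsub>fiber_group x0\<^esub> (path_class x0 \<alpha>) \<in> small_loop_classes x0 U)))"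
proof -
  have "(\<exists>\<gamma>'\<in>loops_in U x0. homotopic_paths UNIV \<gamma>' (\<alpha> +++ \<gamma> +++ reversepath \<alpha>)) \<longleftrightarrow>
      path_class x0 \<alpha> \<otimes>\<^bsub>fiber_group x0\<^esub> path_class x0 \<gamma>
        \<otimes>\<^bsub>fiber_group x0\<^esub> inv\<^bsub>fiber_group x0\<^esub> (path_class x0 \<alpha>) \<in> small_loop_classes x0 U"
    if g: "\<gamma> \<in> loops_in UNIV x0" for U \<gamma>
  proof -
    have l: "\<alpha> +++ \<gamma> +++ reversepath \<alpha> \<in> loops_in UNIV x0"
      using a g by (intro join_in_loops_in reversepath_in_loops_in)
    \<comment> \<open>Concatenation \<open>+++\<close> associates to the right and the group product
      to the left; the group law bridges the difference.\<close>
    have "path_class x0 \<alpha> \<otimes>\<^bsub>fiber_group x0\<^esub> path_class x0 \<gamma>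
        \<otimes>\<^bsub>fiber_group x0\<^esub> inv\<^bsub>fiber_group x0\<^esub> (path_class x0 \<alpha>) =
      path_class x0 \<alpha> \<otimes>\<^bsub>fiber_group x0\<^esub> (path_class x0 \<gamma>
        \<otimes>\<^bsub>fiber_group x0\<^esub> path_class x0 (reversepath \<alpha>))"
      unfolding fiber_group_inv[OF a] using a g
      by (intro monoid.m_assoc[OF group.is_monoid[OF group_fiber_group]])
         (auto simp: fiber_eq reversepath_in_loops_in)
    also have "\<dots> = path_class x0 (\<alpha> +++ \<gamma> +++ reversepath \<alpha>)"
      using a g by (simp add: fiber_group_mult join_in_loops_in reversepath_in_loops_in)
    finally show ?thesis
      using path_class_loop_eq_iff[OF loops_in_UNIV l]
      by (auto simp: small_loop_classes_def image_iff eq_commute[of "path_class x0 (\<alpha> +++ _)"])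
  qed
  moreover have "path \<alpha>" "pathstart \<alpha> = x0" "pathfinish \<alpha> = x0"
    using a by (auto simp: loops_in_def)
  ultimately show ?thesis
    unfolding SLT_path_def small_loop_classes_def by (simp add: loops_in_UNIV)
qed

theorem proposition2p8:
  fixes x0 :: "'a::topological_space"
  shows "SLTL_at x0 \<longleftrightarrow> topological_group (fiber_group x0) (fiber_topology x0)"
proof -
  let ?\<H> = "small_loop_classes x0 ` {U. open U \<and> x0 \<in> U}"
  have "topological_group (fiber_group x0) (fiber_topology x0) \<longleftrightarrow>
    (\<forall>g\<in>carrier (fiber_group x0). \<forall>H\<in>?\<H>. \<exists>K\<in>?\<H>. \<forall>k\<in>K.
      g \<otimes>\<^bsub>fiber_group x0\<^esub> k \<otimes>\<^bsub>fiber_group x0\<^esub> inv\<^bsub>fiber_group x0\<^esub> g \<in> H)"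
  proof (rule group.topological_group_subgroup_family_iff[OF group_fiber_group])
    show "\<And>H. H \<in> ?\<H> \<Longrightarrow> subgroup H (fiber_group x0)"
      using subgroup_small_loop_classes by blast
    show "?\<H> \<noteq> {}" by (auto intro!: exI[of _ UNIV])
  qed (rule openin_fiber_topology_iff)
  \<comment> \<open>Group elements are replaced by representing loops, and the subgroups
    \<open>H\<close> and \<open>K\<close> by the neighbourhoods \<open>U\<close> and
    \<open>V\<close> that define them.\<close>
  also have "\<dots> \<longleftrightarrow> SLTL_at x0"
    by (auto simp: SLTL_at_def SLT_path_loop_iff fiber_eq)
  finally show ?thesis by simp
qed

end
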